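(* $\pi(\vec T_2,2)=1$. That is, every $n$-vertex partially directed graph $\vec H$ that does not contain $\vec T_2$ as a subgraph satisfies $\alpha(\vec H)+2\beta(\vec H)\le 1+o_{n\to\infty}(1)$, and $1$ is the smallest constant with this property.
   Context: A partially directed graph ($2$-PDG) on vertex set $V$ specifies for each pair $\{u,v\}\subseteq V$ exactly one of: no edge, an undirected edge, or an edge directed toward $u$ or toward $v$. $\alpha(\vec H)=e_u(\vec H)/\binom n2$, $\beta(\vec H)=e_d(\vec H)/\binom n2$, where $e_u,e_d$ count undirected and directed edges. $\vec F$ is a subgraph of $\vec H$ if a PDG isomorphic to $\vec F$ can be obtained from $\vec H$ by deleting vertices, deleting edges and forgetting directions of edges. $\vec T_2$ is the PDG on vertices $\{1,2,3\}$ with undirected edges $\{1,2\},\{2,3\}$ and the edge $\{1,3\}$ directed toward $3$. For a PDG $\vec F$ and real $\theta$, $\pi(\vec F,\theta)$ is the smallest real number such that every $n$-vertex $\vec F$-free PDG $\vec H$ satisfies $\alpha(\vec H)+\theta\beta(\vec H)\le\pi(\vec F,\theta)+o_{n\to\infty}(1)$. *)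

theory Defs
  imports Complex_Main
begin

text \<open>A pair \<open>(u, v)\<close> in \<open>dedges\<close> is an edge between \<open>u\<close> and \<open>v\<close> directed toward \<open>v\<close>.\<close>

record 'a pdg =
  verts :: "'a set"
  uedges :: "'a set set"
  dedges :: "('a \<times> 'a) set"

definition is_pdg :: "'a pdg \<Rightarrow> bool" where
  "is_pdg H \<longleftrightarrow>
     finite (verts H) \<and>
     uedges H \<subseteq> {{u, v} | u v. u \<in> verts H \<and> v \<in> verts H \<and> u \<noteq> v} \<and>
     dedges H \<subseteq> {(u, v). u \<in> verts H \<and> v \<in> verts H \<and> u \<noteq> v} \<and>
     (\<forall>u v. (u, v) \<in> dedges H \<longrightarrow> (v, u) \<notin> dedges H \<and> {u, v} \<notin> uedges H)"

text \<open>For fewer than two vertices the denominator is 0, and so both densities are 0.\<close>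

definition alpha :: "'a pdg \<Rightarrow> real" where
  "alpha H = real (card (uedges H)) / real (card (verts H) choose 2)"

definition beta :: "'a pdg \<Rightarrow> real" where
  "beta H = real (card (dedges H)) / real (card (verts H) choose 2)"

inductive pdg_step :: "'a pdg \<Rightarrow> 'a pdg \<Rightarrow> bool" where
  delete_vertex:
    "x \<in> verts H \<Longrightarrow>
     pdg_step H \<lparr>verts = verts H - {x},
                 uedges = {e \<in> uedges H. x \<notin> e},
                 dedges = {(u, v) \<in> dedges H. u \<noteq> x \<and> v \<noteq> x}\<rparr>"
| delete_undirected:
    "e \<in> uedges H \<Longrightarrow> pdg_step H (H\<lparr>uedges := uedges H - {e}\<rparr>)"
| delete_directed:
    "(u, v) \<in> dedges H \<Longrightarrow> pdg_step H (H\<lparr>dedges := dedges H - {(u, v)}\<rparr>)"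
| forget_direction:
    "(u, v) \<in> dedges H \<Longrightarrow>
     pdg_step H (H\<lparr>uedges := insert {u, v} (uedges H), dedges := dedges H - {(u, v)}\<rparr>)"

definition pdg_isomorphic :: "'a pdg \<Rightarrow> 'b pdg \<Rightarrow> bool" where
  "pdg_isomorphic F G \<longleftrightarrow>
     (\<exists>f. bij_betw f (verts F) (verts G) \<and>
          uedges G = (\<lambda>e. f ` e) ` uedges F \<and>
          dedges G = (\<lambda>(u, v). (f u, f v)) ` dedges F)"

definition pdg_subgraph :: "'a pdg \<Rightarrow> 'b pdg \<Rightarrow> bool" where
  "pdg_subgraph F H \<longleftrightarrow> (\<exists>G. pdg_step\<^sup>*\<^sup>* H G \<and> pdg_isomorphic F G)"

definition T2 :: "nat pdg" where
  "T2 = \<lparr>verts = {1, 2, 3}, uedges = {{1, 2}, {2, 3}}, dedges = {(1, 3)}\<rparr>"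

text \<open>
  \<open>asymp_bound F \<theta> c\<close> says that every \<open>n\<close>-vertex \<open>F\<close>-free PDG \<open>H\<close> satisfies
  \<open>\<alpha>(H) + \<theta> \<beta>(H) \<le> c + o(1)\<close>; the error term depends only on \<open>n\<close>. Vertices
  are natural numbers without loss of generality, every finite PDG being isomorphic to such a one.
\<close>

definition asymp_bound :: "'a pdg \<Rightarrow> real \<Rightarrow> real \<Rightarrow> bool" where
  "asymp_bound F \<theta> c \<longleftrightarrow>
     (\<exists>err :: nat \<Rightarrow> real. err \<longlonglongrightarrow> 0 \<and>
        (\<forall>n. \<forall>H :: nat pdg. is_pdg H \<and> card (verts H) = n \<and> \<not> pdg_subgraph F H \<longrightarrow>
           alpha H + \<theta> * beta H \<le> c + err n))"

text \<open>The value is meaningful only if a least such \<open>c\<close> exists.\<close>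

definition pdg_pi :: "'a pdg \<Rightarrow> real \<Rightarrow> real" where
  "pdg_pi F \<theta> = (LEAST c. asymp_bound F \<theta> c)"

end

theory Submission
  imports Defs
begin

text \<open>
  A PDG is free of \<open>T2\<close> exactly if no directed edge lies in a triangle of the underlying graph.
  Hence, if \<open>u\<close> and \<open>v\<close> span a directed edge, every other vertex is adjacent to at most one of them,
  so deleting \<open>u\<close> and \<open>v\<close> lowers \<open>e\<^sub>u + 2 e\<^sub>d\<close> by at most \<open>2 (n - 2) + 2 = (n\<^sup>2 - (n - 2)\<^sup>2) / 2\<close>.
  By induction \<open>e\<^sub>u + 2 e\<^sub>d \<le> n\<^sup>2 / 2\<close>, the bound being trivial without directed edges. Complete
  undirected graphs show that the constant 1 is optimal.
\<close>

section \<open>Finding \<open>T2\<close> in a triangle with a directed edge\<close>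

text \<open>This and the next two lemmas turn single steps into batches with an explicit result.
  They are to be used in this order: forget directions, delete undirected edges, delete
  vertices.\<close>

lemma pdg_steps_forget_directions:
  assumes "finite E" "E \<subseteq> dedges H"
  shows "pdg_step\<^sup>*\<^sup>* H (H\<lparr>uedges := uedges H \<union> (\<lambda>(u, v). {u, v}) ` E, dedges := dedges H - E\<rparr>)"
  using assms
proof (induction E rule: finite_induct)
  case empty
  then show ?case by simp
next
  case (insert e E)
  obtain u v where e: "e = (u, v)" by (cases e)
  let ?K = "H\<lparr>uedges := uedges H \<union> (\<lambda>(u, v). {u, v}) ` E, dedges := dedges H - E\<rparr>"
  have "pdg_step\<^sup>*\<^sup>* H ?K" using insert by simp
  moreover have "pdg_step ?K (?K\<lparr>uedges := insert {u, v} (uedges ?K), dedges := dedges ?K - {(u, v)}\<rparr>)"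
    using insert e by (intro forget_direction) auto
  moreover have "?K\<lparr>uedges := insert {u, v} (uedges ?K), dedges := dedges ?K - {(u, v)}\<rparr> =
      H\<lparr>uedges := uedges H \<union> (\<lambda>(u, v). {u, v}) ` insert e E, dedges := dedges H - insert e E\<rparr>"
    by (rule pdg.equality) (auto simp: e)
  ultimately show ?case by (simp only: rtranclp.rtrancl_into_rtrancl)
qed

lemma pdg_steps_delete_undirected:
  assumes "finite E" "E \<subseteq> uedges H"
  shows "pdg_step\<^sup>*\<^sup>* H (H\<lparr>uedges := uedges H - E\<rparr>)"
  using assms
proof (induction E rule: finite_induct)
  case empty
  then show ?case by simp
next
  case (insert e E)
  let ?K = "H\<lparr>uedges := uedges H - E\<rparr>"
  have "pdg_step\<^sup>*\<^sup>* H ?K" using insert by simp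
  moreover have "pdg_step ?K (?K\<lparr>uedges := uedges ?K - {e}\<rparr>)"
    using insert by (intro delete_undirected) auto
  moreover have "?K\<lparr>uedges := uedges ?K - {e}\<rparr> = H\<lparr>uedges := uedges H - insert e E\<rparr>"
    by (rule pdg.equality) auto
  ultimately show ?case by (simp only: rtranclp.rtrancl_into_rtrancl)
qed

text \<open>If edges are removed first, the vertices in \<open>X\<close> are isolated. The filters
  in \<open>delete_vertex\<close> are then vacuous and both edge sets survive unchanged.\<close>

lemma pdg_steps_delete_isolated:
  assumes "finite X" "X \<subseteq> verts H" "\<And>e. e \<in> uedges H \<Longrightarrow> e \<inter> X = {}"
    and "\<And>u v. (u, v) \<in> dedges H \<Longrightarrow> u \<notin> X \<and> v \<notin> X"
  shows "pdg_step\<^sup>*\<^sup>* H (H\<lparr>verts := verts H - X\<rparr>)"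
  using assms
proof (induction X rule: finite_induct)
  case empty
  then show ?case by simp
next
  case (insert x X)
  let ?K = "H\<lparr>verts := verts H - X\<rparr>"
  let ?L = "\<lparr>verts = verts ?K - {x}, uedges = {e \<in> uedges ?K. x \<notin> e},
             dedges = {(u, v) \<in> dedges ?K. u \<noteq> x \<and> v \<noteq> x}\<rparr>"
  have "pdg_step\<^sup>*\<^sup>* H ?K"
    using insert.prems by (intro insert.IH) blast+
  moreover have "pdg_step ?K ?L"
    using insert by (intro delete_vertex) auto
  moreover have "?L = H\<lparr>verts := verts H - insert x X\<rparr>"
    using insert.prems by (intro pdg.equality) fastforce+
  ultimately show ?case by (simp only: rtranclp.rtrancl_into_rtrancl)
qed

definition pdg_adj :: "'a pdg \<Rightarrow> 'a \<Rightarrow> 'a \<Rightarrow> bool" where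
  "pdg_adj H u v \<longleftrightarrow> {u, v} \<in> uedges H \<or> (u, v) \<in> dedges H \<or> (v, u) \<in> dedges H"

lemma is_pdg_adjD:
  assumes "is_pdg H" "pdg_adj H u v"
  shows "u \<in> verts H" "v \<in> verts H" "u \<noteq> v"
  using assms unfolding is_pdg_def pdg_adj_def by (auto simp: doubleton_eq_iff)

lemma is_pdg_finite:
  assumes "is_pdg H"
  shows "finite (verts H)" "finite (uedges H)" "finite (dedges H)"
proof -
  show fin: "finite (verts H)" using assms by (simp add: is_pdg_def)
  have "uedges H \<subseteq> Pow (verts H)" and "dedges H \<subseteq> verts H \<times> verts H"
    using assms by (auto simp: is_pdg_def)
  then show "finite (uedges H)" "finite (dedges H)"
    using finite_subset[of _ "Pow (verts H)"] finite_subset[of _ "verts H \<times> verts H"] fin by simp_all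
qed

text \<open>Adjacency to \<open>z\<close> of any type suffices, since a directed edge at
  \<open>z\<close> can be made undirected. The vertices \<open>u\<close>, \<open>z\<close>,
  \<open>v\<close> become 1, 2, 3 of \<open>T2\<close>.\<close>

lemma T2_subgraph_of_triangle:
  assumes H: "is_pdg H" and uv: "(u, v) \<in> dedges H" and uz: "pdg_adj H u z" and vz: "pdg_adj H v z"
  shows "pdg_subgraph T2 H"
proof -
  have dist: "u \<noteq> v" "u \<noteq> z" "v \<noteq> z" and V: "{u, v, z} \<subseteq> verts H"
    using is_pdg_adjD[OF H uz] is_pdg_adjD[OF H vz] is_pdg_adjD[OF H, of u v] uv
    by (auto simp: pdg_adj_def)
  let ?E = "dedges H - {(u, v)}"
  let ?H1 = "H\<lparr>uedges := uedges H \<union> (\<lambda>(u, v). {u, v}) ` ?E, dedges := dedges H - ?E\<rparr>"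
  let ?E1 = "uedges ?H1 - {{u, z}, {z, v}}"
  let ?H2 = "?H1\<lparr>uedges := uedges ?H1 - ?E1\<rparr>"
  let ?X = "verts H - {u, v, z}"
  let ?H3 = "?H2\<lparr>verts := verts ?H2 - ?X\<rparr>"
  have d: "dedges ?H2 = {(u, v)}" using uv by auto
  \<comment> \<open>An edge at \<open>z\<close> is never \<open>(u, v)\<close>, because
    \<open>z\<close> differs from both ends; if directed, it therefore lies in
    \<open>?E\<close>.\<close>
  have "{a, z} \<in> uedges H \<union> (\<lambda>(u, v). {u, v}) ` ?E" if a: "pdg_adj H a z" "a \<in> {u, v}" for a
  proof -
    consider "{a, z} \<in> uedges H" | "(a, z) \<in> ?E" | "(z, a) \<in> ?E"
      using a dist unfolding pdg_adj_def by blast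
    then show ?thesis
    proof cases
      case 2
      then show ?thesis by (intro UnI2 image_eqI[of _ _ "(a, z)"]) auto
    next
      case 3
      then show ?thesis by (intro UnI2 image_eqI[of _ _ "(z, a)"]) auto
    qed simp
  qed
  from this[OF uz] this[OF vz] have "{u, z} \<in> uedges ?H1" "{v, z} \<in> uedges ?H1"
    by simp_all
  then have e: "uedges ?H2 = {{u, z}, {z, v}}" by (auto simp: insert_commute)
  have s1: "pdg_step\<^sup>*\<^sup>* H ?H1"
    using is_pdg_finite[OF H] by (intro pdg_steps_forget_directions) auto
  have s2: "pdg_step\<^sup>*\<^sup>* ?H1 ?H2"
    using is_pdg_finite[OF H] by (intro pdg_steps_delete_undirected) auto
  have s3: "pdg_step\<^sup>*\<^sup>* ?H2 ?H3"
  proof (rule pdg_steps_delete_isolated)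
    show "finite ?X" using is_pdg_finite[OF H] by simp
    show "e \<inter> ?X = {}" if "e \<in> uedges ?H2" for e
      using that unfolding e by auto
    show "a \<notin> ?X \<and> b \<notin> ?X" if "(a, b) \<in> dedges ?H2" for a b
      using that unfolding d by auto
  qed simp
  have "pdg_step\<^sup>*\<^sup>* H ?H3"
    by (rule rtranclp_trans[OF rtranclp_trans[OF s1 s2] s3])
  moreover have "?H3 = \<lparr>verts = {u, v, z}, uedges = {{u, z}, {z, v}}, dedges = {(u, v)}\<rparr>"
    using V e d by (intro pdg.equality) auto
  moreover have "pdg_isomorphic T2 \<lparr>verts = {u, v, z}, uedges = {{u, z}, {z, v}}, dedges = {(u, v)}\<rparr>"
    unfolding pdg_isomorphic_def
  proof (intro exI conjI)
    let ?f = "\<lambda>i::nat. if i = 1 then u else if i = 2 then z else v"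
    show "bij_betw ?f (verts T2) (verts \<lparr>verts = {u, v, z}, uedges = {{u, z}, {z, v}}, dedges = {(u, v)}\<rparr>)"
      using dist by (auto simp: bij_betw_def inj_on_def T2_def)
  qed (simp_all add: T2_def insert_commute)
  ultimately show ?thesis unfolding pdg_subgraph_def by metis
qed

section \<open>The upper bound\<close>

lemma sum_weights_le_card_squared:
  fixes w :: "'a \<Rightarrow> 'a \<Rightarrow> nat"
  assumes "finite V" "\<And>x y. w x y = w y x" "\<And>x. w x x = 0" "\<And>x y. w x y \<le> 2"
    and "\<And>x y z. \<lbrakk>x \<in> V; y \<in> V; z \<in> V; w x y = 2\<rbrakk> \<Longrightarrow> w x z = 0 \<or> w y z = 0"
  shows "(\<Sum>x\<in>V. \<Sum>y\<in>V. w x y) \<le> (card V)\<^sup>2"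
  using assms(1,5)
proof (induction V rule: finite_psubset_induct)
  case (psubset V)
  note sym = assms(2) and diag = assms(3) and le2 = assms(4)
  show ?case
  proof (cases "\<exists>u\<in>V. \<exists>v\<in>V. w u v = 2")
    case False
    then have "w x y \<le> 1" if "x \<in> V" "y \<in> V" for x y
      using that le2[of x y] by (auto simp: le_less less_2_cases_iff)
    then have "(\<Sum>x\<in>V. \<Sum>y\<in>V. w x y) \<le> (\<Sum>x\<in>V. \<Sum>y\<in>V. 1)"
      by (intro sum_mono) auto
    then show ?thesis by (simp add: power2_eq_square)
  next
    case True
    then obtain u v where uv: "u \<in> V" "v \<in> V" "w u v = 2" by blast
    then have ne: "u \<noteq> v" using diag by force
    define W where "W = V - {u, v}"
    have V: "V = insert u (insert v W)" and notin: "u \<notin> W" "v \<notin> W" and fin: "finite W"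
      using uv psubset.hyps by (auto simp: W_def)
    \<comment> \<open>One of the two weights vanishes because \<open>w u v = 2\<close>.\<close>
    have "w u z + w v z \<le> 2" if "z \<in> W" for z
      using psubset.prems[of u v z] uv that le2[of u z] le2[of v z] by (auto simp: W_def)
    then have "(\<Sum>z\<in>W. w u z + w v z) \<le> (\<Sum>z\<in>W. 2)"
      by (intro sum_mono)
    then have star: "(\<Sum>z\<in>W. w u z) + (\<Sum>z\<in>W. w v z) \<le> 2 * card W"
      by (simp add: sum.distrib)
    have IH: "(\<Sum>x\<in>W. \<Sum>y\<in>W. w x y) \<le> (card W)\<^sup>2"
      using uv psubset.prems by (intro psubset.IH) (auto simp: W_def)
    have col: "(\<Sum>z\<in>W. w z a) = (\<Sum>z\<in>W. w a z)" for a
      using sym by (intro sum.cong) auto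
    \<comment> \<open>The 4 is \<open>w u v + w v u\<close>; the factor 2 counts each pair between
      \<open>{u, v}\<close> and \<open>W\<close> in both orders. With m = \<open>card W\<close> the
      bound becomes 4 + 4m + m^2 = (m + 2)^2.\<close>
    have "(\<Sum>x\<in>V. \<Sum>y\<in>V. w x y) =
        4 + 2 * ((\<Sum>z\<in>W. w u z) + (\<Sum>z\<in>W. w v z)) + (\<Sum>x\<in>W. \<Sum>y\<in>W. w x y)"
      using fin notin ne uv(3) sym[of v u] col by (simp add: V sum.distrib diag)
    also have "\<dots> \<le> 4 + 2 * (2 * card W) + (card W)\<^sup>2"
      using star IH by (intro add_mono mult_left_mono) auto
    also have "\<dots> = (card V)\<^sup>2"
      using fin notin ne by (simp add: V power2_eq_square)
    finally show ?thesis .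
  qed
qed

text \<open>The ordered pairs split into disjoint fibres over the edges, and each fibre has two
  elements because an edge has distinct ends.\<close>

lemma card_ordered_pairs_of_uedges:
  assumes "is_pdg H"
  shows "card {(x, y). {x, y} \<in> uedges H} = 2 * card (uedges H)"
proof -
  have two: "card {(x, y). {x, y} = e} = 2 \<and> finite {(x, y). {x, y} = e}" if "e \<in> uedges H" for e
  proof -
    from that assms obtain a b where ab: "e = {a, b}" "a \<noteq> b"
      unfolding is_pdg_def by blast
    then have "{(x, y). {x, y} = e} = {(a, b), (b, a)}"
      by (auto simp: doubleton_eq_iff)
    with ab show ?thesis by simp
  qed
  have "{(x, y). {x, y} \<in> uedges H} = (\<Union>e\<in>uedges H. {(x, y). {x, y} = e})" by auto
  also have "card \<dots> = (\<Sum>e\<in>uedges H. card {(x, y). {x, y} = e})"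
    using is_pdg_finite[OF assms] two by (intro card_UN_disjoint) auto
  also have "\<dots> = 2 * card (uedges H)" using two by simp
  finally show ?thesis .
qed

lemma sum_indicator_pairs:
  assumes "finite V" "{(x, y). P x y} \<subseteq> V \<times> V"
  shows "(\<Sum>x\<in>V. \<Sum>y\<in>V. of_bool (P x y)) = card {(x, y). P x y}"
proof -
  have "(\<Sum>x\<in>V. \<Sum>y\<in>V. of_bool (P x y)) = (\<Sum>p\<in>V \<times> V. of_bool (p \<in> {(x, y). P x y}))"
    by (simp add: sum.cartesian_product case_prod_unfold)
  also have "\<dots> = card ((V \<times> V) \<inter> {(x, y). P x y})"
    using assms(1) by (subst sum_of_bool_eq) auto
  also have "(V \<times> V) \<inter> {(x, y). P x y} = {(x, y). P x y}"
    using assms(2) by blast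
  finally show ?thesis .
qed

lemma T2_free_edge_bound:
  assumes H: "is_pdg H" and free: "\<not> pdg_subgraph T2 H"
  shows "2 * card (uedges H) + 4 * card (dedges H) \<le> (card (verts H))\<^sup>2"
proof -
  \<comment> \<open>Both orientations enter to make \<open>w\<close> symmetric. At most one summand
    is nonzero, since a pair carries at most one edge.\<close>
  define w :: "'a \<Rightarrow> 'a \<Rightarrow> nat" where
    "w x y = of_bool ({x, y} \<in> uedges H) + 2 * of_bool ((x, y) \<in> dedges H)
       + 2 * of_bool ((y, x) \<in> dedges H)" for x y
  note fin = is_pdg_finite[OF H]
  note adjD = is_pdg_adjD[OF H, unfolded pdg_adj_def]
  have excl: "(y, x) \<notin> dedges H \<and> {x, y} \<notin> uedges H" if "(x, y) \<in> dedges H" for x y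
    using H that unfolding is_pdg_def by blast
  have w0: "w x y = 0 \<longleftrightarrow> \<not> pdg_adj H x y" for x y
    by (auto simp: w_def pdg_adj_def)
  have indicator_sums:
    "(\<Sum>x\<in>verts H. \<Sum>y\<in>verts H. of_bool ({x, y} \<in> uedges H)) = card {(x, y). {x, y} \<in> uedges H}"
    "(\<Sum>x\<in>verts H. \<Sum>y\<in>verts H. of_bool ((x, y) \<in> dedges H)) = card {(x, y). (x, y) \<in> dedges H}"
    "(\<Sum>x\<in>verts H. \<Sum>y\<in>verts H. of_bool ((y, x) \<in> dedges H)) = card {(x, y). (y, x) \<in> dedges H}"
    by (rule sum_indicator_pairs[OF fin(1)], use adjD(1,2) in blast)+
  have "(\<Sum>x\<in>verts H. \<Sum>y\<in>verts H. w x y) \<le> (card (verts H))\<^sup>2"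
  proof (rule sum_weights_le_card_squared)
    show "w x y = w y x" for x y
      by (simp add: w_def insert_commute)
    show "w x x = 0" for x
      using is_pdg_adjD(3)[OF H] w0 by blast
    show "w x y \<le> 2" for x y
      using excl[of x y] excl[of y x] by (auto simp: w_def insert_commute of_bool_def)
    show "w x z = 0 \<or> w y z = 0" if "w x y = 2" for x y z
    proof -
      \<comment> \<open>An undirected edge alone gives weight 1. As the orientation is not known,
        the triangle lemma is applied to both orders of \<open>x\<close> and
        \<open>y\<close>.\<close>
      have "(x, y) \<in> dedges H \<or> (y, x) \<in> dedges H"
        using that by (auto simp: w_def of_bool_def split: if_splits)
      then show ?thesis
        using T2_subgraph_of_triangle[OF H, of x y z] T2_subgraph_of_triangle[OF H, of y x z] free
        by (auto simp: w0)
    qed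
  qed (use fin in simp)
  also have "(\<Sum>x\<in>verts H. \<Sum>y\<in>verts H. w x y) =
      card {(x, y). {x, y} \<in> uedges H} + 2 * card {(x, y). (x, y) \<in> dedges H}
        + 2 * card {(x, y). (y, x) \<in> dedges H}"
    unfolding w_def sum.distrib sum_distrib_left[symmetric]
    using indicator_sums by simp
  also have "{(x, y). (y, x) \<in> dedges H} = (dedges H)\<inverse>" by auto
  finally show ?thesis
    using card_ordered_pairs_of_uedges[OF H] by simp
qed

lemma asymp_bound_T2: "asymp_bound T2 2 1"
  unfolding asymp_bound_def
proof (intro exI conjI allI impI)
  \<comment> \<open>At \<open>n = 1\<close> this is \<open>1 / 0 = 0\<close>, still a valid bound because both densities vanish.\<close>
  let ?err = "\<lambda>n::nat. 1 / (real n - 1)"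
  have "filterlim (\<lambda>n::nat. real n - 1) at_top sequentially"
    using filterlim_tendsto_add_at_top[OF tendsto_const[of "-1"] filterlim_real_sequentially]
    by simp
  then show "?err \<longlonglongrightarrow> 0"
    by (intro tendsto_divide_0[OF tendsto_const] filterlim_at_top_imp_at_infinity)
  fix n :: nat and H :: "nat pdg"
  assume H: "is_pdg H \<and> card (verts H) = n \<and> \<not> pdg_subgraph T2 H"
  show "alpha H + 2 * beta H \<le> 1 + ?err n"
  proof (cases "n \<ge> 2")
    case False
    \<comment> \<open>At \<open>n = 0\<close> the error is -1, so the claim reads 0 \<le> 0.\<close>
    then have "n = 0 \<or> n = 1" by linarith
    then show ?thesis using H by (auto simp: alpha_def beta_def binomial_eq_0)
  next
    case True
    have "real (2 * card (uedges H) + 4 * card (dedges H)) \<le> real (n\<^sup>2)"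
      using T2_free_edge_bound[of H] H by (intro of_nat_mono) auto
    then have le: "real (card (uedges H)) + 2 * real (card (dedges H)) \<le> (real n)\<^sup>2 / 2" by simp
    have ch: "real (n choose 2) = real n * (real n - 1) / 2"
      using True by (simp add: choose_two real_of_nat_div)
    have "alpha H + 2 * beta H = (real (card (uedges H)) + 2 * real (card (dedges H))) / (n choose 2)"
      using H by (simp add: alpha_def beta_def add_divide_distrib)
    also have "\<dots> \<le> ((real n)\<^sup>2 / 2) / (n choose 2)"
      using le by (rule divide_right_mono) simp
    \<comment> \<open>The quotient is n / (n - 1), which is where the error term comes from.\<close>
    also have "\<dots> = 1 + ?err n"
      unfolding ch using True by (simp add: field_simps power2_eq_square)
    finally show ?thesis .
  qed
qed

section \<open>The lower bound\<close>

text \<open>No step creates a directed edge. Hence \<open>T2\<close>, which has one, is not a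
  subgraph of any undirected graph.\<close>

lemma pdg_steps_no_dedges:
  assumes "pdg_step\<^sup>*\<^sup>* H G" "dedges H = {}"
  shows "dedges G = {}"
  using assms
proof (induction rule: rtranclp_induct)
  case (step G K)
  from step.hyps(2) step.IH[OF step.prems] show ?case by cases auto
qed

definition complete_pdg :: "nat \<Rightarrow> nat pdg" where
  "complete_pdg n = \<lparr>verts = {..<n}, uedges = {e. e \<subseteq> {..<n} \<and> card e = 2}, dedges = {}\<rparr>"

lemma is_pdg_complete: "is_pdg (complete_pdg n)"
  by (auto simp: is_pdg_def complete_pdg_def card_2_iff)

lemma complete_pdg_T2_free: "\<not> pdg_subgraph T2 (complete_pdg n)"
proof
  assume "pdg_subgraph T2 (complete_pdg n)"
  then obtain G where "pdg_step\<^sup>*\<^sup>* (complete_pdg n) G" "pdg_isomorphic T2 G"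
    unfolding pdg_subgraph_def by blast
  then show False
    using pdg_steps_no_dedges[of "complete_pdg n" G]
    by (auto simp: pdg_isomorphic_def T2_def complete_pdg_def)
qed

lemma alpha_complete_pdg:
  assumes "n \<ge> 2"
  shows "alpha (complete_pdg n) = 1"
  using assms n_subsets[of "{..<n}" 2] by (simp add: alpha_def complete_pdg_def)

text \<open>Complete undirected graphs give 1 \<le> \<open>c + err n\<close> for all
  \<open>n \<ge> 2\<close>, where the density has a nonzero denominator; the limit yields the
  claim.\<close>

lemma asymp_bound_T2_ge_1:
  assumes "asymp_bound T2 2 c"
  shows "1 \<le> c"
proof -
  obtain err :: "nat \<Rightarrow> real" where lim: "err \<longlonglongrightarrow> 0"
    and err: "\<And>n H. is_pdg (H :: nat pdg) \<and> card (verts H) = n \<and> \<not> pdg_subgraph T2 H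
                \<Longrightarrow> alpha H + 2 * beta H \<le> c + err n"
    using assms unfolding asymp_bound_def by blast
  have "1 \<le> c + err n" if "n \<ge> 2" for n
  proof -
    have "alpha (complete_pdg n) + 2 * beta (complete_pdg n) \<le> c + err n"
      by (rule err) (simp add: is_pdg_complete complete_pdg_T2_free, simp add: complete_pdg_def)
    moreover have "beta (complete_pdg n) = 0"
      by (simp add: beta_def complete_pdg_def)
    ultimately show ?thesis using alpha_complete_pdg[OF that] by simp
  qed
  moreover have "(\<lambda>n. c + err n) \<longlonglongrightarrow> c"
    using tendsto_add[OF tendsto_const lim, of c] by simp
  ultimately show ?thesis
    by (intro LIMSEQ_le_const) auto
qed

theorem theorem2p2:
  shows "pdg_pi T2 2 = 1
       \<and> asymp_bound T2 2 1
       \<and> (\<forall>c. asymp_bound T2 2 c \<longrightarrow> 1 \<le> c)"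
  using asymp_bound_T2 asymp_bound_T2_ge_1 Least_equality[of "asymp_bound T2 2" 1]
  unfolding pdg_pi_def by blast

end
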